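(* For all real symmetric $d\times d$ matrices $A$ and $B$, \[ \mathbb{E}_Q\det(xI-A-QBQ^T)=\mathbb{E}_P\det(xI-A-PBP^T), \] where $Q$ is a Haar-random $d\times d$ real orthogonal matrix and $P$ is a uniformly random $d\times d$ signed permutation matrix.
   Context: A signed permutation matrix is a matrix with entries in $\{0,\pm1\}$ having exactly one nonzero entry in each row and each column; a uniform random one is the product of a diagonal matrix with independent uniform $\pm1$ entries and a uniformly random permutation matrix. *)

theory Defs
  imports "HOL-Probability.Probability"
begin

definition signed_permutation_matrices :: "(real^'n^'n) set" where
  "signed_permutation_matrices =
     {P. (\<forall>i j. P $ i $ j \<in> {0, 1, -1}) \<and>
         (\<forall>i. \<exists>!j. P $ i $ j \<noteq> 0) \<and>
         (\<forall>j. \<exists>!i. P $ i $ j \<noteq> 0)}"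

lemma mat_1_signed_permutation: "mat 1 \<in> signed_permutation_matrices"
  by (auto simp: signed_permutation_matrices_def mat_def)

lemma finite_vec_entries:
  assumes "finite S"
  shows "finite {v :: 'a^'n. \<forall>i. v $ i \<in> S}"
proof (rule finite_subset)
  show "{v :: 'a^'n. \<forall>i. v $ i \<in> S} \<subseteq> vec_lambda ` (UNIV \<rightarrow>\<^sub>E S)"
  proof
    fix v :: "'a^'n" assume "v \<in> {v. \<forall>i. v $ i \<in> S}"
    then show "v \<in> vec_lambda ` (UNIV \<rightarrow>\<^sub>E S)"
      by (intro image_eqI[of _ _ "vec_nth v"]) auto
  qed
  show "finite (vec_lambda ` (UNIV \<rightarrow>\<^sub>E S) :: ('a^'n) set)"
    using assms by (intro finite_imageI finite_PiE) auto
qed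

lemma finite_signed_permutation_matrices:
  "finite (signed_permutation_matrices :: (real^'n^'n) set)"
proof (rule finite_subset)
  let ?R = "{v :: real^'n. \<forall>j. v $ j \<in> {0, 1, -1}}"
  show "signed_permutation_matrices \<subseteq> {P :: real^'n^'n. \<forall>i. P $ i \<in> ?R}"
    by (auto simp: signed_permutation_matrices_def)
  show "finite {P :: real^'n^'n. \<forall>i. P $ i \<in> ?R}"
    by (intro finite_vec_entries) simp
qed

text \<open>Haar probability measure on the orthogonal group, as a measure on the Borel sets of the
  group (in the topology inherited from the space of matrices). It is characterised by left
  invariance; as the group is compact, such a measure exists, is unique, and is also right
  invariant.\<close>

definition haar_orthogonal :: "(real^'n^'n) measure \<Rightarrow> bool" where
  "haar_orthogonal \<mu> \<longleftrightarrow>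
     prob_space \<mu> \<and>
     sets \<mu> = sets (restrict_space borel {Q. orthogonal_matrix Q}) \<and>
     (\<forall>U. orthogonal_matrix U \<longrightarrow> distr \<mu> \<mu> (\<lambda>Q. U ** Q) = \<mu>)"

end

theory Submission
  imports Defs
begin

text \<open>
  Write \<open>M = x I - A\<close> and \<open>X = - B\<close>. Left invariance of Haar measure under the signed permutation
  matrices \<open>P\<close> gives \<open>E\<^sub>Q det (M + Q X Q\<^sup>T) = E\<^sub>Q E\<^sub>P det (M + P (Q X Q\<^sup>T) P\<^sup>T)\<close>, so it suffices that
  \<open>E\<^sub>P det (M + P X P\<^sup>T)\<close> is invariant under orthogonal conjugation of \<open>X\<close>. Averaging over the
  diagonal signs leaves in the expansion of the determinant only the products of complementary
  principal minors of \<open>M\<close> and \<open>P X P\<^sup>T\<close>; averaging over permutations then replaces each principal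
  minor of size \<open>k\<close> by the mean of all of them. The sum of all principal minors of size \<open>k\<close> is,
  up to indexing, a coefficient of \<open>det (t I + X)\<close>, hence conjugation invariant.
\<close>

subsection \<open>Sign and permutation matrices\<close>

definition sign_vectors :: "('n \<Rightarrow> real) set" where
  "sign_vectors = {s. \<forall>i. s i \<in> {1, -1}}"

definition sign_matrix :: "('n \<Rightarrow> real) \<Rightarrow> real^'n^'n" where
  "sign_matrix s = (\<chi> i j. if i = j then s i else 0)"

text \<open>Row \<open>i\<close> has its one in column \<open>p i\<close>, so products reverse
  composition: \<open>perm_matrix p ** perm_matrix q\<close> is the matrix of
  \<open>q \<circ> p\<close>.\<close>

definition perm_matrix :: "('n \<Rightarrow> 'n) \<Rightarrow> real^'n^'n" where
  "perm_matrix p = (\<chi> i j. if j = p i then 1 else 0)"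

lemma finite_sign_vectors: "finite (sign_vectors :: ('n::finite \<Rightarrow> real) set)"
proof -
  have "(sign_vectors :: ('n \<Rightarrow> real) set) = UNIV \<rightarrow>\<^sub>E {1, -1}"
    by (auto simp: sign_vectors_def PiE_def Pi_def)
  moreover have "finite ((UNIV :: 'n set) \<rightarrow>\<^sub>E {1, -1 :: real})"
    by (intro finite_PiE) auto
  ultimately show ?thesis
    by (rule ssubst)
qed

lemma sign_vectors_nonempty: "sign_vectors \<noteq> {}"
proof -
  have "(\<lambda>_. 1) \<in> sign_vectors"
    by (simp add: sign_vectors_def)
  then show ?thesis
    by blast
qed

lemma sign_vectors_square: "s \<in> sign_vectors \<Longrightarrow> s i * s i = 1"
  by (auto simp: sign_vectors_def dest: spec[of _ i])

lemma sign_matrix_mult_nth: "(sign_matrix s ** X) $ i $ j = s i * X $ i $ j"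
  by (simp add: sign_matrix_def matrix_matrix_mult_def if_distrib[of "\<lambda>a. a * _"] cong: if_cong)

lemma mult_sign_matrix_nth: "(X ** sign_matrix s) $ i $ j = X $ i $ j * s j"
  by (simp add: sign_matrix_def matrix_matrix_mult_def if_distrib[of "\<lambda>a. _ * a"] cong: if_cong)

lemma transpose_sign_matrix: "transpose (sign_matrix s) = sign_matrix s"
  by (auto simp: sign_matrix_def transpose_def vec_eq_iff)

lemma sign_matrix_square: "s \<in> sign_vectors \<Longrightarrow> sign_matrix s ** sign_matrix s = mat 1"
  by (simp add: vec_eq_iff sign_matrix_mult_nth mat_def) (simp add: sign_matrix_def sign_vectors_square)

lemma orthogonal_sign_matrix: "s \<in> sign_vectors \<Longrightarrow> orthogonal_matrix (sign_matrix s)"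
  by (simp add: orthogonal_matrix_def transpose_sign_matrix sign_matrix_square)

lemma perm_matrix_mult_nth: "(perm_matrix p ** X) $ i $ j = X $ p i $ j"
  by (simp add: perm_matrix_def matrix_matrix_mult_def if_distrib[of "\<lambda>a. a * _"] cong: if_cong)

lemma mult_transpose_perm_matrix_nth: "(X ** transpose (perm_matrix p)) $ i $ j = X $ i $ p j"
  by (simp add: perm_matrix_def matrix_matrix_mult_def transpose_def if_distrib[of "\<lambda>a. _ * a"]
      cong: if_cong)

lemma orthogonal_matrix_if_mult_transpose:
  fixes Q :: "real^'n^'n"
  assumes "Q ** transpose Q = mat 1"
  shows "orthogonal_matrix Q"
  using assms matrix_left_right_inverse[of Q "transpose Q"] by (simp add: orthogonal_matrix_def)

lemma orthogonal_perm_matrix: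
  assumes "bij p"
  shows "orthogonal_matrix (perm_matrix p)"
proof (rule orthogonal_matrix_if_mult_transpose)
  show "perm_matrix p ** transpose (perm_matrix p) = mat 1"
    using bij_is_inj[OF assms]
    by (auto simp: vec_eq_iff mult_transpose_perm_matrix_nth mat_def)
       (auto simp: perm_matrix_def inj_eq)
qed

lemma perm_matrix_inverse_cancel:
  assumes "\<And>i. q (p i) = i"
  shows "perm_matrix p ** (perm_matrix q ** X) = X"
  using assms by (simp add: vec_eq_iff perm_matrix_mult_nth)

lemma det_orthogonal_conj:
  fixes Q X :: "real^'n^'n"
  assumes "orthogonal_matrix Q"
  shows "det (Q ** X ** transpose Q) = det X"
proof -
  have "det Q * det Q = 1"
    using det_orthogonal_matrix[OF assms] by auto
  then show ?thesis
    by (simp add: det_mul)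
qed

text \<open>The rows are orthonormal: each has a single entry, equal to 1 or -1, and the column
  condition makes the supports of distinct rows disjoint.\<close>

lemma orthogonal_signed_permutation:
  fixes P :: "real^'n^'n"
  assumes "P \<in> signed_permutation_matrices"
  shows "orthogonal_matrix P"
proof (rule orthogonal_matrix_if_mult_transpose)
  have 01: "P $ i $ j \<in> {0, 1, -1}" and row: "\<exists>!j. P $ i $ j \<noteq> 0"
    and col: "\<exists>!i. P $ i $ j \<noteq> 0" for i j
    using assms by (auto simp: signed_permutation_matrices_def)
  have "(\<Sum>k\<in>UNIV. P $ i $ k * P $ j $ k) = (if i = j then 1 else 0)" for i j
  proof (cases "i = j")
    case True
    obtain l where l: "P $ i $ l \<noteq> 0" "\<And>k. k \<noteq> l \<Longrightarrow> P $ i $ k = 0"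
      using row[of i] by metis
    have "(\<Sum>k\<in>UNIV. P $ i $ k * P $ i $ k) = (\<Sum>k\<in>{l}. P $ i $ k * P $ i $ k)"
      using l by (intro sum.mono_neutral_right) auto
    then show ?thesis
      using True l(1) 01[of i l] by auto
  next
    case False
    then have "P $ i $ k * P $ j $ k = 0" for k
      using col[of k] by (metis mult_eq_0_iff)
    then show ?thesis
      using False by (simp only: sum.neutral_const if_False)
  qed
  then show "P ** transpose P = mat 1"
    by (simp add: vec_eq_iff matrix_matrix_mult_def transpose_def mat_def)
qed

section \<open>Left translations of the set of signed permutation matrices\<close>

lemma sign_matrix_mult_signed_permutation:
  assumes "s \<in> sign_vectors" "P \<in> signed_permutation_matrices"
  shows "sign_matrix s ** P \<in> signed_permutation_matrices"
proof -
  have s: "s i = 1 \<or> s i = -1" for i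
    using assms(1) by (auto simp: sign_vectors_def)
  then have nz: "s i \<noteq> 0" for i
    by (metis zero_neq_neg_one zero_neq_one)
  have "s i * P $ i $ j \<in> {0, 1, -1}" for i j
  proof -
    have "P $ i $ j \<in> {0, 1, -1}"
      using assms(2) by (simp add: signed_permutation_matrices_def)
    then show ?thesis
      using s[of i] by auto
  qed
  then show ?thesis
    using assms(2) nz by (simp add: signed_permutation_matrices_def sign_matrix_mult_nth)
qed

lemma perm_matrix_mult_signed_permutation:
  assumes "bij p" "P \<in> signed_permutation_matrices"
  shows "perm_matrix p ** P \<in> signed_permutation_matrices"
proof -
  have "\<exists>!i. P $ p i $ j \<noteq> 0" for j
  proof -
    obtain k where k: "P $ k $ j \<noteq> 0" "\<And>i. P $ i $ j \<noteq> 0 \<Longrightarrow> i = k"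
      using assms(2) by (auto simp: signed_permutation_matrices_def) metis
    obtain l where "k = p l"
      using assms(1) by (metis bij_pointE)
    with k show ?thesis
      using bij_is_inj[OF assms(1)] by (metis inj_eq)
  qed
  then show ?thesis
    using assms(2) by (simp add: signed_permutation_matrices_def perm_matrix_mult_nth)
qed

lemma sum_signed_permutation_sign_matrix:
  assumes "s \<in> sign_vectors"
  shows "(\<Sum>P\<in>signed_permutation_matrices. f (sign_matrix s ** P)) =
    (\<Sum>P\<in>signed_permutation_matrices. f P)"
  by (rule sum.reindex_bij_witness[where i = "(**) (sign_matrix s)" and j = "(**) (sign_matrix s)"])
     (use assms in \<open>simp_all add: sign_matrix_mult_signed_permutation matrix_mul_assoc
        sign_matrix_square\<close>)

lemma sum_signed_permutation_perm_matrix: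
  assumes "bij p"
  shows "(\<Sum>P\<in>signed_permutation_matrices. f (perm_matrix p ** P)) =
    (\<Sum>P\<in>signed_permutation_matrices. f P)"
  by (rule sum.reindex_bij_witness[where i = "(**) (perm_matrix (inv p))" and j = "(**) (perm_matrix p)"])
     (use assms in \<open>simp_all add: perm_matrix_mult_signed_permutation perm_matrix_inverse_cancel
        bij_imp_bij_inv bij_is_inj bij_is_surj surj_f_inv_f\<close>)

subsection \<open>Principal minors\<close>

text \<open>The determinant of \<open>principal_block T X\<close> is the principal minor of \<open>X\<close> on the index set \<open>T\<close>.\<close>

definition principal_block :: "'n set \<Rightarrow> real^'n^'n \<Rightarrow> real^'n^'n" where
  "principal_block T X =
     (\<chi> i j. if i \<in> T \<and> j \<in> T then X $ i $ j else if i = j then 1 else 0)"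

text \<open>This is the elementary symmetric polynomial of degree \<open>k\<close> in the
  eigenvalues of \<open>X\<close>, for \<open>k\<close> up to the dimension.\<close>

definition principal_minor_sum :: "nat \<Rightarrow> real^'n^'n \<Rightarrow> real" where
  "principal_minor_sum k X = (\<Sum>T | card T = k. det (principal_block T X))"

text \<open>The product is block diagonal, with \<open>X\<close> on \<open>T\<close> and
  \<open>M\<close> on the complement. It turns a product of complementary principal minors into one
  determinant with one Leibniz expansion.\<close>

lemma principal_blocks_mult_nth:
  "(principal_block (- T) M ** principal_block T X) $ i $ j =
    (if i \<in> T \<and> j \<in> T then X $ i $ j else if i \<notin> T \<and> j \<notin> T then M $ i $ j else 0)"
proof -
  have "(principal_block (- T) M ** principal_block T X) $ i $ j =
      (\<Sum>k\<in>UNIV. principal_block (- T) M $ i $ k * principal_block T X $ k $ j)"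
    by (simp add: matrix_matrix_mult_def)
  \<comment> \<open>For \<open>i\<close> in \<open>T\<close> the left factor has a unit row, leaving
    only \<open>k = i\<close>; otherwise only \<open>k = j\<close> can contribute.\<close>
  also have "\<dots> = (\<Sum>k\<in>UNIV. if k = (if i \<in> T then i else j) then
      (if i \<in> T \<and> j \<in> T then X $ i $ j else if i \<notin> T \<and> j \<notin> T then M $ i $ j else 0) else 0)"
    by (rule sum.cong) (auto simp: principal_block_def)
  finally show ?thesis
    by simp
qed

text \<open>If \<open>p\<close> preserves \<open>T\<close>, every sign with index in
  \<open>T\<close> occurs twice and each product is 1. Otherwise some \<open>m\<close> in
  \<open>T\<close> has \<open>p m\<close> outside \<open>T\<close>; by injectivity the sign at
  \<open>p m\<close> occurs exactly once, so flipping it is a sign-reversing involution and the sum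
  is 0.\<close>

lemma sum_sign_vectors_prod:
  fixes p :: "'n::finite \<Rightarrow> 'n"
  assumes "inj p"
  shows "(\<Sum>s\<in>sign_vectors. \<Prod>i\<in>T. s i * s (p i)) =
    (if p ` T = T then real (card (sign_vectors :: ('n \<Rightarrow> real) set)) else 0)"
proof (cases "p ` T = T")
  case True
  have "(\<Prod>i\<in>T. s i * s (p i)) = 1" if "s \<in> sign_vectors" for s
  proof -
    have "(\<Prod>i\<in>T. s (p i)) = (\<Prod>i\<in>p ` T. s i)"
      using assms by (subst prod.reindex) (auto simp: inj_on_def inj_def)
    then have "(\<Prod>i\<in>T. s i * s (p i)) = (\<Prod>i\<in>T. s i * s i)"
      using True by (simp add: prod.distrib)
    then show ?thesis
      using that by (simp add: sign_vectors_square)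
  qed
  then show ?thesis
    using True by simp
next
  case False
  have "card (p ` T) = card T"
    using assms by (intro card_image) (auto simp: inj_on_def inj_def)
  then have "\<not> p ` T \<subseteq> T"
    using False by (metis card_subset_eq finite)
  then obtain m where m: "m \<in> T" "p m \<notin> T"
    by blast
  define flip :: "('n \<Rightarrow> real) \<Rightarrow> 'n \<Rightarrow> real" where "flip s = s(p m := - s (p m))" for s
  have flip: "flip s \<in> sign_vectors" "flip (flip s) = s" if "s \<in> sign_vectors" for s
    using that by (auto simp: flip_def sign_vectors_def)
  have "(\<Prod>i\<in>T. flip s i * flip s (p i)) = - (\<Prod>i\<in>T. s i * s (p i))" for s
  proof -
    have "(\<Prod>i\<in>T. flip s i * flip s (p i)) =
        flip s m * flip s (p m) * (\<Prod>i\<in>T - {m}. flip s i * flip s (p i))"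
      using m by (simp add: prod.remove)
    also have "(\<Prod>i\<in>T - {m}. flip s i * flip s (p i)) = (\<Prod>i\<in>T - {m}. s i * s (p i))"
      using m assms by (intro prod.cong) (auto simp: flip_def inj_eq)
    also have "flip s m * flip s (p m) = - (s m * s (p m))"
      using m by (auto simp: flip_def)
    also have "- (s m * s (p m)) * (\<Prod>i\<in>T - {m}. s i * s (p i)) = - (\<Prod>i\<in>T. s i * s (p i))"
      using m by (simp add: prod.remove)
    finally show ?thesis .
  qed
  then have "(\<Sum>s\<in>sign_vectors. \<Prod>i\<in>T. s i * s (p i)) =
      (\<Sum>s\<in>sign_vectors. - (\<Prod>i\<in>T. s i * s (p i)))"
    by (intro sum.reindex_bij_witness[where i = flip and j = flip])
       (use flip in \<open>simp_all\<close>)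
  then show ?thesis
    using False by (simp add: sum_negf)
qed

lemma sum_det_add_sign_conj:
  fixes M X :: "real^'n^'n"
  shows "(\<Sum>s\<in>sign_vectors. det (M + sign_matrix s ** X ** sign_matrix s)) =
    real (card (sign_vectors :: ('n \<Rightarrow> real) set)) *
    (\<Sum>T\<in>UNIV. det (principal_block (- T) M) * det (principal_block T X))"
proof -
  let ?N = "real (card (sign_vectors :: ('n \<Rightarrow> real) set))"
  let ?perms = "{p. p permutes (UNIV :: 'n set)}"
  define c where "c p T = (\<Prod>i\<in>T. X $ i $ p i) * (\<Prod>i\<in>- T. M $ i $ p i)" for p T
  have expand: "det (M + sign_matrix s ** X ** sign_matrix s) =
      (\<Sum>p\<in>?perms. \<Sum>T\<in>UNIV. of_int (sign p) * c p T * (\<Prod>i\<in>T. s i * s (p i)))" for s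
  proof -
    have "(\<Prod>i\<in>UNIV. (M + sign_matrix s ** X ** sign_matrix s) $ i $ p i) =
        (\<Sum>T\<in>UNIV. c p T * (\<Prod>i\<in>T. s i * s (p i)))" for p
    proof -
      have "(\<Prod>i\<in>UNIV. (M + sign_matrix s ** X ** sign_matrix s) $ i $ p i) =
          (\<Prod>i\<in>UNIV. X $ i $ p i * (s i * s (p i)) + M $ i $ p i)"
        by (simp add: mult_sign_matrix_nth sign_matrix_mult_nth mult_ac add_ac)
      also have "\<dots> = (\<Sum>T\<in>UNIV. c p T * (\<Prod>i\<in>T. s i * s (p i)))"
        by (simp add: prod_add c_def Compl_eq_Diff_UNIV prod.distrib mult_ac)
      finally show ?thesis .
    qed
    then show ?thesis
      by (simp add: det_def sum_distrib_left mult.assoc)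
  qed
  \<comment> \<open>The block matrix selects the same pairs as the sign sum: if \<open>p\<close>
    moves a point of \<open>T\<close> out of \<open>T\<close>, the product meets a zero
    entry.\<close>
  have block: "(\<Prod>i\<in>UNIV. (principal_block (- T) M ** principal_block T X) $ i $ p i) =
      (if p ` T = T then c p T else 0)" if "p permutes UNIV" for p T
  proof (cases "p ` T = T")
    case True
    have "p i \<in> T \<longleftrightarrow> i \<in> T" for i
      using True permutes_inj[OF that] by (metis inj_image_mem_iff)
    then have "(\<Prod>i\<in>UNIV. (principal_block (- T) M ** principal_block T X) $ i $ p i) =
        (\<Prod>i\<in>UNIV. if i \<in> T then X $ i $ p i else M $ i $ p i)"
      by (intro prod.cong) (auto simp: principal_blocks_mult_nth)
    also have "\<dots> = c p T"
      by (subst prod.If_cases) (auto simp: c_def Compl_eq)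
    finally show ?thesis
      using True by simp
  next
    case False
    have "card (p ` T) = card T"
      using permutes_inj[OF that] by (intro card_image) (auto simp: inj_on_def inj_def)
    then have "\<not> p ` T \<subseteq> T"
      using False by (metis card_subset_eq finite)
    then obtain m where "m \<in> T" "p m \<notin> T"
      by blast
    then have "(principal_block (- T) M ** principal_block T X) $ m $ p m = 0"
      by (simp add: principal_blocks_mult_nth)
    then show ?thesis
      using False by (metis UNIV_I finite prod_zero)
  qed
  have "(\<Sum>s\<in>sign_vectors. det (M + sign_matrix s ** X ** sign_matrix s)) =
      (\<Sum>p\<in>?perms. \<Sum>T\<in>UNIV. of_int (sign p) * c p T *
        (\<Sum>s\<in>sign_vectors. \<Prod>i\<in>T. s i * s (p i)))"
    unfolding expand
    by (subst sum.swap, rule sum.cong[OF refl], subst sum.swap) (simp add: sum_distrib_left)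
  also have "\<dots> = (\<Sum>p\<in>?perms. \<Sum>T\<in>UNIV. ?N * (of_int (sign p) * (if p ` T = T then c p T else 0)))"
    by (intro sum.cong refl) (simp add: sum_sign_vectors_prod permutes_inj)
  also have "\<dots> = (\<Sum>T\<in>UNIV. ?N * (\<Sum>p\<in>?perms. of_int (sign p) * (if p ` T = T then c p T else 0)))"
    by (subst sum.swap) (simp only: sum_distrib_left)
  also have "\<dots> = (\<Sum>T\<in>UNIV. ?N * det (principal_block (- T) M ** principal_block T X))"
    unfolding det_def by (intro sum.cong refl arg_cong2[where f = "(*)"]) (simp add: block)
  finally show ?thesis
    by (simp add: det_mul sum_distrib_left)
qed

section \<open>Principal minor sums as characteristic polynomial coefficients\<close>

lemma sum_sets_by_card:
  fixes f :: "'n::finite set \<Rightarrow> real"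
  shows "(\<Sum>T\<in>UNIV. f T) = (\<Sum>k\<le>CARD('n). \<Sum>T | card T = k. f T)"
proof -
  have "(\<Sum>k\<le>CARD('n). sum f {T \<in> UNIV. card T = k}) = sum f UNIV"
    by (rule sum.group) (auto intro: card_mono)
  then show ?thesis
    by simp
qed

text \<open>This is sign averaging with \<open>M\<close> a scalar matrix: sign conjugation fixes
  \<open>M\<close>, so all summands on the left agree, and the complementary minors of
  \<open>M\<close> are powers of \<open>t\<close>.\<close>

lemma det_scaled_id_add:
  fixes X :: "real^'n^'n"
  shows "det (t *\<^sub>R mat 1 + X) =
    (\<Sum>k\<le>CARD('n). principal_minor_sum (CARD('n) - k) X * t ^ k)"
proof -
  have conj: "t *\<^sub>R mat 1 + sign_matrix s ** X ** sign_matrix s =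
      sign_matrix s ** (t *\<^sub>R mat 1 + X) ** transpose (sign_matrix s)" if "s \<in> sign_vectors" for s
    using that
    by (auto simp: vec_eq_iff transpose_sign_matrix mult_sign_matrix_nth sign_matrix_mult_nth mat_def
        algebra_simps sign_vectors_square)
  have minor: "det (principal_block (- T) (t *\<^sub>R mat 1)) = t ^ (CARD('n) - card T)" for T :: "'n set"
  proof -
    have "det (principal_block (- T) (t *\<^sub>R mat 1)) =
        (\<Prod>i\<in>UNIV. principal_block (- T) (t *\<^sub>R mat 1) $ i $ i)"
      by (rule det_diagonal) (auto simp: principal_block_def mat_def)
    also have "\<dots> = (\<Prod>i\<in>UNIV. if i \<in> - T then t else 1)"
      by (intro prod.cong) (auto simp: principal_block_def mat_def)
    also have "\<dots> = t ^ card (- T)"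
      by (subst prod.If_cases) (auto simp: Compl_eq)
    finally show ?thesis
      by (simp add: Compl_eq_Diff_UNIV card_Diff_subset)
  qed
  let ?N = "real (card (sign_vectors :: ('n \<Rightarrow> real) set))"
  have "?N * det (t *\<^sub>R mat 1 + X) =
      (\<Sum>s\<in>sign_vectors. det (t *\<^sub>R mat 1 + sign_matrix s ** X ** sign_matrix s))"
    by (simp add: conj det_orthogonal_conj orthogonal_sign_matrix)
  also have "\<dots> = ?N * (\<Sum>T\<in>UNIV. t ^ (CARD('n) - card T) * det (principal_block T X))"
    by (simp add: sum_det_add_sign_conj minor)
  finally have "det (t *\<^sub>R mat 1 + X) =
      (\<Sum>T\<in>UNIV. t ^ (CARD('n) - card T) * det (principal_block T X))"
    by (simp add: finite_sign_vectors sign_vectors_nonempty)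
  also have "\<dots> = (\<Sum>k\<le>CARD('n). principal_minor_sum k X * t ^ (CARD('n) - k))"
    by (simp add: sum_sets_by_card principal_minor_sum_def sum_distrib_left mult.commute)
  \<comment> \<open>Reversing the index gives the standard form of a polynomial in \<open>t\<close>,
    ready for comparing coefficients.\<close>
  also have "\<dots> = (\<Sum>k\<le>CARD('n). principal_minor_sum (CARD('n) - k) X * t ^ k)"
    by (rule sum.reindex_bij_witness[where i = "\<lambda>k. CARD('n) - k" and j = "\<lambda>k. CARD('n) - k"]) auto
  finally show ?thesis .
qed

lemma matrix_matrix_add_rdistrib:
  fixes A B :: "'a::semiring_1^'n^'m"
  shows "(A + B) ** C = A ** C + B ** C"
  by (simp add: vec_eq_iff matrix_matrix_mult_def distrib_right sum.distrib)

text \<open>Conjugation leaves \<open>det (t *\<^sub>R mat 1 + X)\<close> unchanged for every real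
  \<open>t\<close>, so the two polynomials have equal coefficients.\<close>

lemma principal_minor_sum_orthogonal_conj:
  fixes Q X :: "real^'n^'n"
  assumes "orthogonal_matrix Q" "k \<le> CARD('n)"
  shows "principal_minor_sum k (Q ** X ** transpose Q) = principal_minor_sum k X"
proof -
  have "t *\<^sub>R mat 1 + Q ** X ** transpose Q = Q ** (t *\<^sub>R mat 1 + X) ** transpose Q" for t
    using assms(1)
    by (simp add: matrix_add_ldistrib matrix_matrix_add_rdistrib orthogonal_matrix_def
        matrix_scalar_ac flip: scalar_matrix_assoc)
  then have "det (t *\<^sub>R mat 1 + Q ** X ** transpose Q) = det (t *\<^sub>R mat 1 + X)" for t
    by (simp add: det_orthogonal_conj assms(1))
  then have "\<forall>t. (\<Sum>j\<le>CARD('n).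
        principal_minor_sum (CARD('n) - j) (Q ** X ** transpose Q) * t ^ j) =
      (\<Sum>j\<le>CARD('n). principal_minor_sum (CARD('n) - j) X * t ^ j)"
    by (simp only: det_scaled_id_add) simp
  then have "\<forall>j\<le>CARD('n). principal_minor_sum (CARD('n) - j) (Q ** X ** transpose Q) =
      principal_minor_sum (CARD('n) - j) X"
    by (simp only: polyfun_eq_coeffs)
  \<comment> \<open>Take \<open>j = CARD('n) - k\<close>, so that
    \<open>CARD('n) - j = k\<close>.\<close>
  then show ?thesis
    using assms(2) by (metis diff_diff_cancel diff_le_self)
qed

subsection \<open>The average over signed permutation matrices\<close>

lemma principal_minor_perm_conj:
  assumes "bij p"
  shows "det (principal_block T (perm_matrix p ** Y ** transpose (perm_matrix p))) =
    det (principal_block (p ` T) Y)"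
proof -
  have "inj p"
    using assms by (rule bij_is_inj)
  then have "principal_block T (perm_matrix p ** Y ** transpose (perm_matrix p)) =
      perm_matrix p ** principal_block (p ` T) Y ** transpose (perm_matrix p)"
    by (auto simp: vec_eq_iff mult_transpose_perm_matrix_nth perm_matrix_mult_nth
        principal_block_def inj_eq inj_image_mem_iff)
  then show ?thesis
    by (simp add: det_orthogonal_conj orthogonal_perm_matrix assms)
qed

text \<open>Permutations act transitively on the sets of a given size: a bijection from
  \<open>S\<close> to \<open>T\<close> is glued to one between the complements.\<close>

lemma obtain_bij_mapping_set:
  fixes S T :: "'n::finite set"
  assumes "card S = card T"
  obtains p where "bij p" "p ` S = T"
proof -
  obtain f where f: "bij_betw f S T"
    using assms by (metis finite finite_same_card_bij)
  have "card (- S) = card (- T)"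
    using assms by (simp add: Compl_eq_Diff_UNIV card_Diff_subset)
  then obtain g where g: "bij_betw g (- S) (- T)"
    by (metis finite finite_same_card_bij)
  define p where "p x = (if x \<in> S then f x else g x)" for x
  have "bij_betw p (S \<union> - S) (T \<union> - T)"
    unfolding p_def using f g by (intro bij_betw_disjoint_Un) auto
  moreover have "p ` S = T"
    using f by (auto simp: p_def bij_betw_def)
  ultimately show ?thesis
    using that by simp
qed

text \<open>Translating by permutation matrices shows that the left side depends on \<open>T\<close>
  only through its size. It therefore equals its mean over all sets of that size, which is computed
  from the conjugation-invariant \<open>principal_minor_sum\<close>.\<close>

lemma sum_signed_permutation_principal_minor:
  fixes X :: "real^'n^'n"
  shows "(\<Sum>P\<in>signed_permutation_matrices. det (principal_block T (P ** X ** transpose P))) =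
    real (card (signed_permutation_matrices :: (real^'n^'n) set)) *
    principal_minor_sum (card T) X / real (card {S :: 'n set. card S = card T})"
proof -
  define h where "h S = (\<Sum>P\<in>signed_permutation_matrices.
    det (principal_block S (P ** X ** transpose P)))" for S
  have h: "h S = h T" if eq: "card S = card T" for S
  proof -
    obtain p where p: "bij p" "p ` S = T"
      using obtain_bij_mapping_set[OF eq] .
    have "h S = (\<Sum>P\<in>signed_permutation_matrices. det (principal_block S
        (perm_matrix p ** P ** X ** transpose (perm_matrix p ** P))))"
      unfolding h_def
      by (rule sum_signed_permutation_perm_matrix[OF p(1), symmetric])
    also have "\<dots> = (\<Sum>P\<in>signed_permutation_matrices. det (principal_block S
        (perm_matrix p ** (P ** X ** transpose P) ** transpose (perm_matrix p))))"
      by (simp add: matrix_mul_assoc matrix_transpose_mul)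
    also have "\<dots> = h T"
      by (simp only: principal_minor_perm_conj[OF p(1)] p(2) h_def)
    finally show ?thesis .
  qed
  have "(\<Sum>S | card S = card T. h S) = (\<Sum>S\<in>{S :: 'n set. card S = card T}. h T)"
    by (rule sum.cong[OF refl], rule h) simp
  then have "real (card {S :: 'n set. card S = card T}) * h T = (\<Sum>S | card S = card T. h S)"
    by simp
  also have "\<dots> = (\<Sum>P\<in>signed_permutation_matrices.
      principal_minor_sum (card T) (P ** X ** transpose P))"
    unfolding h_def principal_minor_sum_def by (rule sum.swap)
  also have "\<dots> = (\<Sum>P\<in>(signed_permutation_matrices :: (real^'n^'n) set).
      principal_minor_sum (card T) X)"
    by (intro sum.cong refl principal_minor_sum_orthogonal_conj orthogonal_signed_permutation)
       (auto intro: card_mono)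
  finally have "real (card {S :: 'n set. card S = card T}) * h T =
      real (card (signed_permutation_matrices :: (real^'n^'n) set)) * principal_minor_sum (card T) X"
    by simp
  moreover have "{S :: 'n set. card S = card T} \<noteq> {}"
    by blast
  ultimately show ?thesis
    by (simp add: h_def field_simps card_eq_0_iff)
qed

text \<open>Inserting a further average over signs brings in \<open>sum_det_add_sign_conj\<close>,
  applied to \<open>P ** X ** transpose P\<close>. The resulting formula sees \<open>X\<close> only
  through its principal minor sums.\<close>

lemma sum_signed_permutation_det:
  fixes M X :: "real^'n^'n"
  shows "(\<Sum>P\<in>signed_permutation_matrices. det (M + P ** X ** transpose P)) =
    (\<Sum>T\<in>UNIV. det (principal_block (- T) M) *
      (real (card (signed_permutation_matrices :: (real^'n^'n) set)) *
       principal_minor_sum (card T) X / real (card {S :: 'n set. card S = card T})))"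
proof -
  let ?N = "real (card (sign_vectors :: ('n \<Rightarrow> real) set))"
  let ?SP = "signed_permutation_matrices :: (real^'n^'n) set"
  have "?N * (\<Sum>P\<in>?SP. det (M + P ** X ** transpose P)) =
      (\<Sum>s\<in>(sign_vectors :: ('n \<Rightarrow> real) set). \<Sum>P\<in>?SP. det (M + P ** X ** transpose P))"
    by simp
  also have "\<dots> = (\<Sum>s\<in>sign_vectors. \<Sum>P\<in>?SP.
      det (M + (sign_matrix s ** P) ** X ** transpose (sign_matrix s ** P)))"
    by (rule sum.cong[OF refl]) (rule sum_signed_permutation_sign_matrix[symmetric])
  also have "\<dots> = (\<Sum>s\<in>sign_vectors. \<Sum>P\<in>?SP.
      det (M + sign_matrix s ** (P ** X ** transpose P) ** sign_matrix s))"
    by (simp add: matrix_mul_assoc matrix_transpose_mul transpose_sign_matrix)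
  also have "\<dots> = (\<Sum>P\<in>?SP. ?N * (\<Sum>T\<in>UNIV. det (principal_block (- T) M) *
      det (principal_block T (P ** X ** transpose P))))"
    by (subst sum.swap) (simp only: sum_det_add_sign_conj)
  also have "\<dots> = ?N * (\<Sum>T\<in>UNIV. \<Sum>P\<in>?SP. det (principal_block (- T) M) *
      det (principal_block T (P ** X ** transpose P)))"
    by (subst sum.swap) (simp only: sum_distrib_left)
  finally have "(\<Sum>P\<in>?SP. det (M + P ** X ** transpose P)) =
      (\<Sum>T\<in>UNIV. \<Sum>P\<in>?SP. det (principal_block (- T) M) *
        det (principal_block T (P ** X ** transpose P)))"
    by (simp add: finite_sign_vectors sign_vectors_nonempty)
  then show ?thesis
    by (simp only: sum_signed_permutation_principal_minor flip: sum_distrib_left)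
qed

lemma sum_signed_permutation_det_orthogonal_conj:
  fixes M X Q :: "real^'n^'n"
  assumes "orthogonal_matrix Q"
  shows "(\<Sum>P\<in>signed_permutation_matrices. det (M + P ** (Q ** X ** transpose Q) ** transpose P)) =
    (\<Sum>P\<in>signed_permutation_matrices. det (M + P ** X ** transpose P))"
proof -
  have "card T \<le> CARD('n)" for T :: "'n set"
    by (intro card_mono) auto
  then show ?thesis
    by (simp add: sum_signed_permutation_det principal_minor_sum_orthogonal_conj assms)
qed

subsection \<open>Haar measure\<close>

lemma continuous_on_matrix_mult [continuous_intros]:
  fixes f :: "'a::topological_space \<Rightarrow> real^'n^'m" and g :: "'a \<Rightarrow> real^'k^'n"
  assumes "continuous_on S f" "continuous_on S g"
  shows "continuous_on S (\<lambda>x. f x ** g x)"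
  unfolding matrix_matrix_mult_def using assms by (intro continuous_intros)

lemma continuous_on_transpose [continuous_intros]:
  fixes f :: "'a::topological_space \<Rightarrow> real^'n^'m"
  assumes "continuous_on S f"
  shows "continuous_on S (\<lambda>x. transpose (f x))"
  unfolding transpose_def using assms by (intro continuous_intros)

lemma continuous_on_det [continuous_intros]:
  fixes f :: "'a::topological_space \<Rightarrow> real^'n^'n"
  assumes "continuous_on S f"
  shows "continuous_on S (\<lambda>x. det (f x))"
  unfolding det_def using assms by (intro continuous_intros)

text \<open>Rows of an orthogonal matrix are unit vectors, which bounds its norm. Compactness makes
  continuous functions on the group bounded, hence integrable for Haar measure.\<close>

lemma compact_orthogonal_matrices: "compact {Q :: real^'n^'n. orthogonal_matrix Q}"
proof -
  have "closed {Q :: real^'n^'n. transpose Q ** Q = mat 1}"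
    by (intro closed_Collect_eq continuous_intros)
  moreover have "bounded {Q :: real^'n^'n. orthogonal_matrix Q}"
  proof (rule boundedI)
    fix Q :: "real^'n^'n"
    assume "Q \<in> {Q. orthogonal_matrix Q}"
    then have "norm (Q $ i) = 1" for i
      by (simp add: orthogonal_matrix_orthonormal_rows row_def vec_nth_inverse)
    then show "norm Q \<le> sqrt (real CARD('n))"
      by (simp add: norm_vec_def L2_set_def)
  qed
  ultimately show ?thesis
    by (simp add: compact_eq_bounded_closed orthogonal_matrix)
qed

lemma haar_orthogonal_space:
  fixes \<mu> :: "(real^'n^'n) measure"
  assumes "haar_orthogonal \<mu>"
  shows "space \<mu> = {Q. orthogonal_matrix Q}"
proof -
  have "space \<mu> = space (restrict_space borel {Q :: real^'n^'n. orthogonal_matrix Q})"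
    using assms by (intro sets_eq_imp_space_eq) (simp add: haar_orthogonal_def)
  then show ?thesis
    by (simp add: space_restrict_space)
qed

lemma haar_orthogonal_measurable_continuous:
  fixes \<mu> :: "(real^'n^'n) measure" and f :: "real^'n^'n \<Rightarrow> 'b::topological_space"
  assumes "haar_orthogonal \<mu>" "continuous_on {Q. orthogonal_matrix Q} f"
  shows "f \<in> borel_measurable \<mu>"
proof -
  have "sets \<mu> = sets (restrict_space borel {Q :: real^'n^'n. orthogonal_matrix Q})"
    using assms(1) by (simp add: haar_orthogonal_def)
  then show ?thesis
    using borel_measurable_continuous_on_restrict[OF assms(2)]
    by (simp cong: measurable_cong_sets)
qed

lemma haar_orthogonal_integrable_continuous:
  fixes \<mu> :: "(real^'n^'n) measure" and f :: "real^'n^'n \<Rightarrow> real"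
  assumes "haar_orthogonal \<mu>" "continuous_on {Q. orthogonal_matrix Q} f"
  shows "integrable \<mu> f"
proof -
  interpret prob_space \<mu>
    using assms(1) by (simp add: haar_orthogonal_def)
  have "bounded (f ` {Q. orthogonal_matrix Q})"
    by (intro compact_imp_bounded compact_continuous_image assms compact_orthogonal_matrices)
  then obtain C where "\<And>Q. orthogonal_matrix Q \<Longrightarrow> norm (f Q) \<le> C"
    by (auto simp: bounded_iff)
  then show ?thesis
    using assms
    by (intro integrable_const_bound[where B = C] haar_orthogonal_measurable_continuous)
       (auto simp: haar_orthogonal_space)
qed

lemma haar_orthogonal_integral_left_mult:
  fixes \<mu> :: "(real^'n^'n) measure" and f :: "real^'n^'n \<Rightarrow> real"
  assumes "haar_orthogonal \<mu>" "orthogonal_matrix U" "f \<in> borel_measurable \<mu>"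
  shows "(\<integral>Q. f (U ** Q) \<partial>\<mu>) = (\<integral>Q. f Q \<partial>\<mu>)"
proof -
  have sets: "sets \<mu> = sets (restrict_space borel {Q :: real^'n^'n. orthogonal_matrix Q})"
    using assms(1) by (simp add: haar_orthogonal_def)
  have "(\<lambda>Q. U ** Q) \<in> borel_measurable \<mu>"
    using assms(1) by (intro haar_orthogonal_measurable_continuous continuous_intros)
  \<comment> \<open>The translation must be measurable into the group itself, not just into all
    matrices, before \<open>integral_distr\<close> applies.\<close>
  then have "(\<lambda>Q. U ** Q) \<in> measurable \<mu> (restrict_space borel {Q. orthogonal_matrix Q})"
    using assms(1,2)
    by (intro measurable_restrict_space2) (auto simp: haar_orthogonal_space orthogonal_matrix_mul)
  then have "(\<lambda>Q. U ** Q) \<in> measurable \<mu> \<mu>"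
    by (simp add: sets cong: measurable_cong_sets)
  then have "(\<integral>Q. f Q \<partial>distr \<mu> \<mu> (\<lambda>Q. U ** Q)) = (\<integral>Q. f (U ** Q) \<partial>\<mu>)"
    using assms(3) by (rule integral_distr)
  then show ?thesis
    using assms(1,2) by (simp add: haar_orthogonal_def)
qed

text \<open>Replace \<open>Q\<close> by \<open>P ** Q\<close> for each signed permutation
  \<open>P\<close> and exchange the finite sum with the integral. The integrand is then constant on
  the group.\<close>

lemma haar_orthogonal_expected_det:
  fixes \<mu> :: "(real^'n^'n) measure" and M X :: "real^'n^'n"
  assumes "haar_orthogonal \<mu>"
  shows "real (card (signed_permutation_matrices :: (real^'n^'n) set)) *
      (\<integral>Q. det (M + Q ** X ** transpose Q) \<partial>\<mu>) =
    (\<Sum>P\<in>signed_permutation_matrices. det (M + P ** X ** transpose P))"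
proof -
  interpret prob_space \<mu>
    using assms by (simp add: haar_orthogonal_def)
  let ?SP = "signed_permutation_matrices :: (real^'n^'n) set"
  define F where "F Q = det (M + Q ** X ** transpose Q)" for Q
  have F: "F \<in> borel_measurable \<mu>"
    unfolding F_def using assms
    by (intro haar_orthogonal_measurable_continuous continuous_intros)
  have int: "integrable \<mu> (\<lambda>Q. F (P ** Q))" for P
    unfolding F_def using assms
    by (intro haar_orthogonal_integrable_continuous continuous_intros)
  have "real (card ?SP) * (\<integral>Q. F Q \<partial>\<mu>) = (\<Sum>P\<in>?SP. \<integral>Q. F (P ** Q) \<partial>\<mu>)"
    using haar_orthogonal_integral_left_mult[OF assms orthogonal_signed_permutation F] by simp
  also have "\<dots> = (\<integral>Q. (\<Sum>P\<in>?SP. F (P ** Q)) \<partial>\<mu>)"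
    by (simp add: int)
  also have "\<dots> = (\<integral>Q. (\<Sum>P\<in>?SP. F P) \<partial>\<mu>)"
  proof (rule Bochner_Integration.integral_cong[OF refl])
    fix Q
    assume "Q \<in> space \<mu>"
    then have "orthogonal_matrix Q"
      using assms by (simp add: haar_orthogonal_space)
    \<comment> \<open>The sum on the left is the signed permutation sum for
      \<open>Q ** X ** transpose Q\<close> in place of \<open>X\<close>.\<close>
    then show "(\<Sum>P\<in>?SP. F (P ** Q)) = (\<Sum>P\<in>?SP. F P)"
      using sum_signed_permutation_det_orthogonal_conj[of Q M X]
      by (simp add: F_def matrix_transpose_mul matrix_mul_assoc)
  qed
  finally show ?thesis
    by (simp add: F_def prob_space)
qed

theorem theorem2p4:
  fixes A B :: "real^'n^'n" and \<mu> :: "(real^'n^'n) measure" and x :: real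
  assumes "transpose A = A" and "transpose B = B"
    and "haar_orthogonal \<mu>"
  shows "(\<integral>Q. det (x *\<^sub>R mat 1 - A - Q ** B ** transpose Q) \<partial>\<mu>) =
    measure_pmf.expectation (pmf_of_set signed_permutation_matrices)
      (\<lambda>P. det (x *\<^sub>R mat 1 - A - P ** B ** transpose P))"
proof -
  let ?SP = "signed_permutation_matrices :: (real^'n^'n) set"
  \<comment> \<open>Moving the minus sign onto \<open>B\<close> gives the form
    \<open>M + Q ** X ** transpose Q\<close> treated above.\<close>
  have neg: "x *\<^sub>R mat 1 - A - Q ** B ** transpose Q =
      (x *\<^sub>R mat 1 - A) + Q ** (- B) ** transpose Q" for Q
    by (simp add: vec_eq_iff matrix_matrix_mult_def sum_negf)
  have SP: "?SP \<noteq> {}"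
    using mat_1_signed_permutation by blast
  then have "real (card ?SP) \<noteq> 0"
    by (simp add: finite_signed_permutation_matrices)
  then show ?thesis
    using haar_orthogonal_expected_det[OF assms(3), of "x *\<^sub>R mat 1 - A" "- B"]
    unfolding neg integral_pmf_of_set[OF SP finite_signed_permutation_matrices]
    by (simp add: field_simps)
qed

end
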